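(* The countable product of lines $\mathbb R^\omega$ (with the product topology and coordinatewise vector space operations) contains a Borel linear subspace $L\subseteq\mathbb R^\omega$ which is Haar-meager and Haar-null in $\mathbb R^\omega$ but cannot be covered by countably many closed Haar-meager sets in $\mathbb R^\omega$.
   Context: Let $X$ be a Polish Abelian group, written additively, and let $2^\omega=\{0,1\}^\omega$ be the Cantor cube. A Borel subset $A$ of $X$ is called Haar-null if there exists a Borel probability measure $\mu$ on $X$ such that $\mu(A+x)=0$ for all $x\in X$. A Borel subset $A$ of $X$ is called Haar-meager if there exists a continuous map $f:2^\omega\to X$ such that for every $x\in X$ the preimage $f^{-1}[A+x]$ is a meager subset of $2^\omega$. *)

theory Defs
  imports "HOL-Probability.Probability" "HOL-Library.Function_Algebras"
begin

text \<open>
  The space of real sequences is the type \<^typ>\<open>nat \<Rightarrow> real\<close>: the library equips it with the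
  product topology and with the pointwise group operations. The coordinatewise scalar
  multiplication and the continuity of the group operations are added here.
\<close>

instantiation "fun" :: (type, real_vector) real_vector
begin

definition scaleR_fun :: "real \<Rightarrow> ('a \<Rightarrow> 'b) \<Rightarrow> 'a \<Rightarrow> 'b"
  where "scaleR_fun c f = (\<lambda>i. c *\<^sub>R f i)"

instance
  by standard (simp_all add: scaleR_fun_def fun_eq_iff scaleR_add_left scaleR_add_right)

end

lemma tendsto_fun_iff:
  fixes f :: "'c \<Rightarrow> 'a \<Rightarrow> 'b::topological_space"
  shows "(f \<longlongrightarrow> l) F \<longleftrightarrow> (\<forall>i. ((\<lambda>x. f x i) \<longlongrightarrow> l i) F)"
  using limitin_componentwise[of "\<lambda>_. euclidean" UNIV f l F]
  by (simp add: euclidean_product_topology)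

instance "fun" :: (type, topological_ab_group_add) topological_ab_group_add
proof
  fix a b :: "'a \<Rightarrow> 'b"
  have fst: "((\<lambda>x. fst x i) \<longlongrightarrow> a i) (nhds a \<times>\<^sub>F nhds b)" for i
    using tendsto_fun_iff[of fst a "nhds a \<times>\<^sub>F nhds b"] filterlim_fst by blast
  have snd: "((\<lambda>x. snd x i) \<longlongrightarrow> b i) (nhds a \<times>\<^sub>F nhds b)" for i
    using tendsto_fun_iff[of snd b "nhds a \<times>\<^sub>F nhds b"] filterlim_snd by blast
  show "((\<lambda>x. fst x + snd x) \<longlongrightarrow> a + b) (nhds a \<times>\<^sub>F nhds b)"
    unfolding tendsto_fun_iff by (auto intro!: tendsto_add fst snd)
  have "((\<lambda>x. x i) \<longlongrightarrow> a i) (nhds a)" for i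
    using tendsto_fun_iff[of "\<lambda>x. x" a "nhds a"] filterlim_ident by blast
  then show "(uminus \<longlongrightarrow> - a) (nhds a)"
    unfolding tendsto_fun_iff by (auto intro!: tendsto_minus)
qed

definition nowhere_dense :: "'a::topological_space set \<Rightarrow> bool"
  where "nowhere_dense A \<longleftrightarrow> interior (closure A) = {}"

definition meager :: "'a::topological_space set \<Rightarrow> bool"
  where "meager A \<longleftrightarrow> (\<exists>N::nat \<Rightarrow> 'a set. (\<forall>n. nowhere_dense (N n)) \<and> A = (\<Union>n. N n))"

text \<open>
  Polish Abelian groups are the types in the intersection of the two classes below; only the
  topology and the group structure, not the particular metric, enter the definitions.
  The Cantor cube is \<^typ>\<open>nat \<Rightarrow> bool\<close> with the product of the discrete topologies.
  Translates of Borel sets are Borel, so \<^const>\<open>emeasure\<close> never takes its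
  default value 0 for non-measurable sets in the definition of Haar-null sets.
\<close>

definition haar_null :: "'a::{polish_space, topological_ab_group_add} set \<Rightarrow> bool"
  where "haar_null A \<longleftrightarrow> A \<in> sets borel \<and>
    (\<exists>\<mu>. prob_space \<mu> \<and> sets \<mu> = sets borel \<and>
      (\<forall>x. emeasure \<mu> ((\<lambda>a. a + x) ` A) = 0))"

definition haar_meager :: "'a::{polish_space, topological_ab_group_add} set \<Rightarrow> bool"
  where "haar_meager A \<longleftrightarrow> A \<in> sets borel \<and>
    (\<exists>f::(nat \<Rightarrow> bool) \<Rightarrow> 'a. continuous_on UNIV f \<and>
      (\<forall>x. meager (f -` ((\<lambda>a. a + x) ` A))))"

lemma borel_translate:
  fixes A :: "'a::topological_ab_group_add set"
  assumes "A \<in> sets borel"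
  shows "(\<lambda>a. a + x) ` A \<in> sets borel"
proof -
  have "continuous_on UNIV (\<lambda>a::'a. a + - x)"
    unfolding continuous_on_def by (intro ballI tendsto_add tendsto_ident_at tendsto_const)
  then have "(\<lambda>a. a + - x) \<in> borel_measurable borel"
    by (rule borel_measurable_continuous_onI)
  from measurable_sets[OF this assms] have "(\<lambda>a. a + - x) -` A \<in> sets borel"
    by simp
  also have "(\<lambda>a. a + - x) -` A = (\<lambda>a. a + x) ` A"
  proof (intro set_eqI iffI)
    fix y assume "y \<in> (\<lambda>a. a + - x) -` A"
    then show "y \<in> (\<lambda>a. a + x) ` A"
      by (intro image_eqI[of _ _ "y + - x"]) simp_all
  qed auto
  finally show ?thesis .
qed

end

theory Submission
  imports Defs
begin

text \<open>
  Let \<open>L\<close> be the span of a set \<open>Q\<close> of sequences that grow so irregularly that every nontrivial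
  linear combination of them is unbounded. Then \<open>L\<close> meets each translate of \<open>[0,1]\<^sup>\<omega>\<close> in at
  most one point, which makes \<open>L\<close> Haar-null and Haar-meager for trivial reasons.

  A point \<open>x\<close> of \<open>Q\<close> has each entry in one of the sparse intervals \<open>((m+1)!, 2(m+1)!)\<close>, and \<open>m\<close>
  encodes a finite-dimensional rational approximation of \<open>x\<close> itself, whose precision increases along \<open>x\<close>.
  Hence distinct points of \<open>Q\<close> eventually use distinct intervals, of very different magnitude.
  On the other hand, while the approximation is kept unchanged the entries can be chosen in intervals of any
  length, so each compact set fits after a translation that depends on it. A closed Haar-meager
  set therefore cannot contain all these choices, and countably many such sets are escaped one after the other.

  As \<open>Q\<close> is \<open>G\<^sub>\<delta>\<close> and independent, the representation of the elements of \<open>L\<close> is unique, so \<open>L\<close> is a countable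
  union of injective continuous images of \<open>G\<^sub>\<delta>\<close> sets; by the Lusin-Souslin theorem it is Borel.
\<close>

subsection \<open>The Lusin-Souslin theorem\<close>

definition borel_separated :: "'a::topological_space set \<Rightarrow> 'a set \<Rightarrow> bool"
  where "borel_separated A B \<longleftrightarrow> (\<exists>D\<in>sets borel. A \<subseteq> D \<and> B \<inter> D = {})"

lemma borel_separated_UN:
  fixes A B :: "'i::countable \<Rightarrow> 'a::topological_space set"
  assumes "\<And>i j. i \<in> I \<Longrightarrow> j \<in> J \<Longrightarrow> borel_separated (A i) (B j)"
  shows "borel_separated (\<Union>i\<in>I. A i) (\<Union>j\<in>J. B j)"
proof (cases "J = {}")
  case True
  then show ?thesis
    unfolding borel_separated_def by (intro bexI[of _ UNIV]) auto
next
  case False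
  obtain D where D: "\<And>i j. i \<in> I \<Longrightarrow> j \<in> J \<Longrightarrow> D i j \<in> sets borel \<and> A i \<subseteq> D i j \<and> B j \<inter> D i j = {}"
    using assms unfolding borel_separated_def by metis
  have "(\<Union>i\<in>I. \<Inter>j\<in>J. D i j) \<in> sets borel"
    using D False by (intro sets.countable_UN' sets.countable_INT') auto
  moreover have "(\<Union>i\<in>I. A i) \<subseteq> (\<Union>i\<in>I. \<Inter>j\<in>J. D i j)"
    using D by (intro UN_mono INT_greatest) auto
  moreover have "(\<Union>j\<in>J. B j) \<inter> (\<Union>i\<in>I. \<Inter>j\<in>J. D i j) = {}"
  proof (rule equals0I)
    fix z assume "z \<in> (\<Union>j\<in>J. B j) \<inter> (\<Union>i\<in>I. \<Inter>j\<in>J. D i j)"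
    then obtain i j where "i \<in> I" "j \<in> J" "z \<in> B j" "z \<in> D i j"
      by blast
    with D[of i j] show False
      by blast
  qed
  ultimately show ?thesis
    unfolding borel_separated_def by blast
qed

text \<open>Separators of all pairs of pieces would combine to one of the unions, so failure of
  separation survives in some pair of pieces. This drives the recursion in
  \<open>lusin_separation\<close>.\<close>

lemma borel_separated_cover:
  assumes "countable \<V>" "countable \<W>" "A \<subseteq> \<Union>\<V>" "B \<subseteq> \<Union>\<W>" "\<not> borel_separated (f ` A) (f ` B)"
  obtains V W where "V \<in> \<V>" "W \<in> \<W>" "\<not> borel_separated (f ` (A \<inter> V)) (f ` (B \<inter> W))"
proof (rule ccontr)
  assume "\<not> thesis"
  with that have *: "borel_separated (f ` (A \<inter> V)) (f ` (B \<inter> W))" if "V \<in> \<V>" "W \<in> \<W>" for V W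
    using that by blast
  \<comment> \<open>The covers are reindexed by natural numbers, as
    \<open>borel_separated_UN\<close> needs indices of a countable type.\<close>
  have eq: "f ` C = (\<Union>i\<in>to_nat_on \<U> ` \<U>. f ` (C \<inter> from_nat_into \<U> i))"
    if "C \<subseteq> \<Union>\<U>" "countable \<U>" for C \<U>
    using that by (fastforce simp: from_nat_into_to_nat_on)
  have "borel_separated (f ` A) (f ` B)"
    using assms(1-4) *
    by (subst eq[of A \<V>], simp, simp, subst eq[of B \<W>], simp, simp, intro borel_separated_UN)
       (auto simp: from_nat_into_to_nat_on)
  with assms(5) show False ..
qed

text \<open>The condition on closures keeps limits of points of \<open>V\<close> in
  \<open>O'\<close>, so that shrinking pieces converge inside a given
  \<open>G\<^sub>\<delta>\<close> set.\<close>

lemma small_open_cover: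
  fixes O' :: "'a::{metric_space, second_countable_topology} set"
  assumes "open O'" "0 < e"
  obtains \<V> where "countable \<V>" "O' \<subseteq> \<Union>\<V>"
    "\<And>V. V \<in> \<V> \<Longrightarrow> open V \<and> closure V \<subseteq> O' \<and> (\<forall>x\<in>V. \<forall>y\<in>V. dist x y < e)"
proof -
  obtain \<B> :: "'a set set" where \<B>: "countable \<B>" "topological_basis \<B>"
    using ex_countable_basis by blast
  define \<V> where "\<V> = {V \<in> \<B>. closure V \<subseteq> O' \<and> (\<forall>x\<in>V. \<forall>y\<in>V. dist x y < e)}"
  have "O' \<subseteq> \<Union>\<V>"
  proof
    fix p assume "p \<in> O'"
    then obtain d where d: "0 < d" "cball p d \<subseteq> O'"
      using assms(1) open_contains_cball by blast
    define r where "r = min d (e / 2)"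
    obtain V where V: "V \<in> \<B>" "p \<in> V" "V \<subseteq> ball p r"
      using topological_basisE[OF \<B>(2), of "ball p r" p] d assms(2) unfolding r_def by auto
    have "closure V \<subseteq> cball p r"
      by (rule closure_minimal) (use V(3) in auto)
    also have "\<dots> \<subseteq> O'"
      using d(2) subset_cball[of r d p] by (simp add: r_def)
    finally have "closure V \<subseteq> O'" .
    moreover have "dist x y < e" if "x \<in> V" "y \<in> V" for x y
    proof -
      have "dist p x < e / 2" "dist p y < e / 2"
        using that V(3) by (auto simp: r_def)
      then show ?thesis
        using dist_triangle3[of x y p] by linarith
    qed
    ultimately show "p \<in> \<Union>\<V>"
      using V(1,2) \<open>closure V \<subseteq> O'\<close> unfolding \<V>_def by blast
  qed
  moreover have "open V \<and> closure V \<subseteq> O' \<and> (\<forall>x\<in>V. \<forall>y\<in>V. dist x y < e)" if "V \<in> \<V>" for V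
    using topological_basis_open[OF \<B>(2), of V] that unfolding \<V>_def by blast
  moreover have "countable \<V>"
    using \<B>(1) by (simp add: \<V>_def)
  ultimately show thesis
    by (intro that)
qed

text \<open>Points chosen from the \<open>U k\<close> form a Cauchy sequence: any two of the sets
  are linked through a common point, and their diameters tend to 0. Pairwise meeting replaces
  nestedness, as the sets arising in \<open>lusin_souslin\<close> need not be nested.\<close>

lemma meeting_small_sets_converge:
  fixes U :: "nat \<Rightarrow> 'a::complete_space set"
  assumes meet: "\<And>j k. U j \<inter> U k \<noteq> {}"
    and small: "\<And>k x y. x \<in> U k \<Longrightarrow> y \<in> U k \<Longrightarrow> dist x y < 1 / Suc k"
  obtains p where "\<And>k. p \<in> closure (U k)" "\<And>W. open W \<Longrightarrow> p \<in> W \<Longrightarrow> \<forall>\<^sub>F k in sequentially. U k \<subseteq> W"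
proof -
  have "\<exists>y. y \<in> U k" for k
    using meet[of k k] by blast
  then obtain u where u: "\<And>k. u k \<in> U k"
    by metis
  have uu: "dist (u j) y < 1 / Suc j + 1 / Suc k" if "y \<in> U k" for j k y
  proof -
    obtain v where "v \<in> U j" "v \<in> U k"
      using meet[of j k] by blast
    then show ?thesis
      using small[OF u[of j] \<open>v \<in> U j\<close>] small[OF \<open>v \<in> U k\<close> that] dist_triangle[of "u j" y v]
      by linarith
  qed
  have inv: "1 / real (Suc k) \<le> 1 / Suc N" if "N \<le> k" for k N
    using that by (simp add: frac_le)
  have "Cauchy u"
  proof (rule metric_CauchyI)
    fix e :: real assume "0 < e"
    then obtain N where "1 / Suc N < e / 2"
      using nat_approx_posE[of "e / 2"] by auto
    then show "\<exists>M. \<forall>m\<ge>M. \<forall>n\<ge>M. dist (u m) (u n) < e"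
      using uu[OF u] inv by (intro exI[of _ N]) (smt (verit) field_sum_of_halves)
  qed
  then obtain p where p: "u \<longlonglongrightarrow> p"
    using convergent_eq_Cauchy by blast
  have near: "dist p y \<le> 1 / Suc k" if "y \<in> U k" for y k
  proof -
    have "(\<lambda>j. dist (u j) y) \<longlonglongrightarrow> dist p y"
      by (intro tendsto_dist p tendsto_const)
    moreover have "(\<lambda>j. 1 / real (Suc j) + 1 / Suc k) \<longlonglongrightarrow> 0 + 1 / Suc k"
      by (intro tendsto_add tendsto_const LIMSEQ_Suc[OF lim_1_over_n])
    ultimately show ?thesis
      using LIMSEQ_le[of "\<lambda>j. dist (u j) y" _ "\<lambda>j. 1 / real (Suc j) + 1 / Suc k"] uu[OF that]
      by (force intro: less_imp_le)
  qed
  show thesis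
  proof
    fix k
    show "p \<in> closure (U k)"
      unfolding closure_approachable
    proof (intro allI impI)
      fix e :: real assume "0 < e"
      then obtain N where N: "1 / Suc N < e"
        using nat_approx_posE by auto
      obtain v where "v \<in> U N" "v \<in> U k"
        using meet[of N k] by blast
      then show "\<exists>y\<in>U k. dist y p < e"
        using near[of v N] N by (auto simp: dist_commute intro!: bexI[of _ v])
    qed
  next
    fix W assume "open W" "p \<in> W"
    then obtain e where e: "0 < e" "ball p e \<subseteq> W"
      by (auto simp: open_contains_ball)
    then obtain N where N: "1 / Suc N < e"
      using nat_approx_posE by auto
    have "U k \<subseteq> W" if "N \<le> k" for k
    proof
      fix y assume "y \<in> U k"
      with near[of y k] inv[OF that] N show "y \<in> W"
        using e(2) by auto
    qed
    then show "\<forall>\<^sub>F k in sequentially. U k \<subseteq> W"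
      by (auto simp: eventually_sequentially)
  qed
qed

text \<open>If separation failed, cutting both sets again and again by small open pieces would keep
  it failing. The pieces shrink to points \<open>p\<close> and \<open>q\<close> of the two
  intersections; disjoint neighbourhoods of \<open>f p\<close> and \<open>f q\<close> then separate
  the images of late pieces, a contradiction.\<close>

lemma lusin_separation:
  fixes f :: "'a::{complete_space, second_countable_topology} \<Rightarrow> 'b::t2_space"
    and A B :: "nat \<Rightarrow> 'a set"
  assumes cont: "continuous_on UNIV f"
    and op: "\<And>k. open (A k)" "\<And>k. open (B k)"
    and disj: "f ` (\<Inter>k. A k) \<inter> f ` (\<Inter>k. B k) = {}"
  shows "borel_separated (f ` (\<Inter>k. A k)) (f ` (\<Inter>k. B k))"
proof (rule ccontr)
  assume neg: "\<not> ?thesis"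
  define good where "good k V O' \<longleftrightarrow> open V \<and> closure V \<subseteq> O' \<and> (\<forall>x\<in>V. \<forall>y\<in>V. dist x y < 1 / Suc k)"
    for k :: nat and V O' :: "'a set"
  define P where "P k X \<longleftrightarrow> fst X \<subseteq> (\<Inter>k. A k) \<and> snd X \<subseteq> (\<Inter>k. B k) \<and>
    \<not> borel_separated (f ` fst X) (f ` snd X)" for k :: nat and X
  define R where "R k X Y \<longleftrightarrow> (\<exists>V W. good k V (A k) \<and> good k W (B k) \<and>
    fst Y = fst X \<inter> V \<and> snd Y = snd X \<inter> W)" for k and X Y :: "'a set \<times> 'a set"
  have "\<exists>X. \<forall>k. P k (X k) \<and> R k (X k) (X (Suc k))"
  proof (rule dependent_nat_choice)
    show "\<exists>X. P 0 X"
      using neg by (intro exI[of _ "(\<Inter>k. A k, \<Inter>k. B k)"]) (simp add: P_def)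
  next
    fix X k assume X: "P k X"
    obtain \<V> where \<V>: "countable \<V>" "A k \<subseteq> \<Union>\<V>" "\<And>V. V \<in> \<V> \<Longrightarrow> good k V (A k)"
      using small_open_cover[OF op(1)[of k], of "1 / Suc k"] unfolding good_def
      by (metis of_nat_0_less_iff zero_less_Suc zero_less_divide_1_iff)
    obtain \<W> where \<W>: "countable \<W>" "B k \<subseteq> \<Union>\<W>" "\<And>W. W \<in> \<W> \<Longrightarrow> good k W (B k)"
      using small_open_cover[OF op(2)[of k], of "1 / Suc k"] unfolding good_def
      by (metis of_nat_0_less_iff zero_less_Suc zero_less_divide_1_iff)
    have "fst X \<subseteq> \<Union>\<V>" "snd X \<subseteq> \<Union>\<W>" "\<not> borel_separated (f ` fst X) (f ` snd X)"
      using X \<V>(2) \<W>(2) unfolding P_def by blast+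
    then obtain V W where VW: "V \<in> \<V>" "W \<in> \<W>"
      "\<not> borel_separated (f ` (fst X \<inter> V)) (f ` (snd X \<inter> W))"
      by (rule borel_separated_cover[OF \<V>(1) \<W>(1)])
    have "P (Suc k) (fst X \<inter> V, snd X \<inter> W)"
      using X VW(3) unfolding P_def by auto
    moreover have "R k X (fst X \<inter> V, snd X \<inter> W)"
      using \<V>(3)[OF VW(1)] \<W>(3)[OF VW(2)] unfolding R_def fst_conv snd_conv by blast
    ultimately show "\<exists>Y. P (Suc k) Y \<and> R k X Y"
      by blast
  qed
  then obtain X where P: "\<And>k. P k (X k)" and R: "\<And>k. R k (X k) (X (Suc k))"
    by blast
  \<comment> \<open>The shift by one skips the uncut pair \<open>X 0\<close>, so \<open>XA k\<close>
    and \<open>XB k\<close> have already been cut at stage \<open>k\<close>.\<close>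
  define XA where "XA k = fst (X (Suc k))" for k
  define XB where "XB k = snd (X (Suc k))" for k
  have dec: "XA k \<subseteq> XA j" "XB k \<subseteq> XB j" if "j \<le> k" for j k
  proof -
    have "XA (Suc n) \<subseteq> XA n" "XB (Suc n) \<subseteq> XB n" for n
      using R[of "Suc n"] unfolding R_def XA_def XB_def by auto
    then show "XA k \<subseteq> XA j" "XB k \<subseteq> XB j"
      using lift_Suc_antimono_le[of XA, OF _ that] lift_Suc_antimono_le[of XB, OF _ that] by auto
  qed
  have sep: "\<not> borel_separated (f ` XA k) (f ` XB k)" for k
    using P[of "Suc k"] by (simp add: P_def XA_def XB_def)
  have ne: "XA k \<noteq> {}" "XB k \<noteq> {}" for k
  proof -
    have "borel_separated {} Y" "borel_separated Y {}" for Y :: "'b set"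
      unfolding borel_separated_def by (rule bexI[of _ "{}"], simp_all, rule bexI[of _ UNIV], simp_all)
    then show "XA k \<noteq> {}" "XB k \<noteq> {}"
      using sep[of k] by auto
  qed
  have small: "closure (XA k) \<subseteq> A k" "\<And>x y. x \<in> XA k \<Longrightarrow> y \<in> XA k \<Longrightarrow> dist x y < 1 / Suc k"
    "closure (XB k) \<subseteq> B k" "\<And>x y. x \<in> XB k \<Longrightarrow> y \<in> XB k \<Longrightarrow> dist x y < 1 / Suc k" for k
  proof -
    obtain V W where VW: "good k V (A k)" "good k W (B k)" "XA k \<subseteq> V" "XB k \<subseteq> W"
      using R[of k] unfolding R_def XA_def XB_def by auto
    then show "closure (XA k) \<subseteq> A k" "closure (XB k) \<subseteq> B k"
      using closure_mono[OF VW(3)] closure_mono[OF VW(4)] unfolding good_def by auto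
    show "dist x y < 1 / Suc k" if "x \<in> XA k" "y \<in> XA k" for x y
      using VW that unfolding good_def by blast
    show "dist x y < 1 / Suc k" if "x \<in> XB k" "y \<in> XB k" for x y
      using VW that unfolding good_def by blast
  qed
  have meet: "XA j \<inter> XA k \<noteq> {}" "XB j \<inter> XB k \<noteq> {}" for j k
    using dec[of j k] dec[of k j] ne[of j] ne[of k] by (cases "j \<le> k"; auto)+
  obtain p where p: "\<And>k. p \<in> closure (XA k)"
    "\<And>W. open W \<Longrightarrow> p \<in> W \<Longrightarrow> \<forall>\<^sub>F k in sequentially. XA k \<subseteq> W"
    using meeting_small_sets_converge[of XA] meet(1) small(2) by metis
  obtain q where q: "\<And>k. q \<in> closure (XB k)"
    "\<And>W. open W \<Longrightarrow> q \<in> W \<Longrightarrow> \<forall>\<^sub>F k in sequentially. XB k \<subseteq> W"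
    using meeting_small_sets_converge[of XB] meet(2) small(4) by metis
  have "p \<in> (\<Inter>k. A k)" "q \<in> (\<Inter>k. B k)"
    using p(1) q(1) small(1,3) by blast+
  then have "f p \<noteq> f q"
    using disj by blast
  then obtain G H where GH: "open G" "open H" "f p \<in> G" "f q \<in> H" "G \<inter> H = {}"
    using hausdorff by metis
  have "\<forall>\<^sub>F k in sequentially. XA k \<subseteq> f -` G \<and> XB k \<subseteq> f -` H"
    using GH(3,4) by (intro eventually_conj p(2) q(2) open_vimage[OF _ cont] GH(1,2)) simp_all
  then obtain k where "XA k \<subseteq> f -` G" "XB k \<subseteq> f -` H"
    by (auto simp: eventually_sequentially)
  then have "borel_separated (f ` XA k) (f ` XB k)"
    unfolding borel_separated_def using GH by (intro bexI[of _ G]) auto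
  with sep show False ..
qed

text \<open>By injectivity, disjoint basic open sets cut out parts of the intersection with disjoint
  images, which Borel sets separate. Enlarging the images to Borel sets \<open>E U\<close> that
  remain disjoint for disjoint \<open>U\<close> exhibits the whole image as a countable Borel
  combination of the \<open>E U\<close>, taken over ever smaller \<open>U\<close>.\<close>

lemma lusin_souslin:
  fixes f :: "'a::{complete_space, second_countable_topology} \<Rightarrow> 'b::metric_space"
    and S :: "nat \<Rightarrow> 'a set"
  assumes cont: "continuous_on UNIV f"
    and op: "\<And>k. open (S k)"
    and inj: "inj_on f (\<Inter>k. S k)"
  shows "f ` (\<Inter>k. S k) \<in> sets borel"
proof -
  let ?S = "\<Inter>k. S k"
  obtain \<B> :: "'a set set" where \<B>: "countable \<B>" "topological_basis \<B>"
    using ex_countable_basis by blast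
  have Bop: "open U" if "U \<in> \<B>" for U
    using \<B>(2) that topological_basis_open by blast
  have "borel_separated (f ` (?S \<inter> U)) (f ` (?S \<inter> V))" if "U \<in> \<B>" "V \<in> \<B>" "U \<inter> V = {}" for U V
  proof -
    have eq: "?S \<inter> W = (\<Inter>k. S k \<inter> W)" for W
      by auto
    have "(?S \<inter> U) \<inter> (?S \<inter> V) = {}"
      using that(3) by blast
    then have "f ` (?S \<inter> U) \<inter> f ` (?S \<inter> V) = {}"
      using inj_on_image_Int[OF inj, of "?S \<inter> U" "?S \<inter> V"] by simp
    then show ?thesis
      unfolding eq by (intro lusin_separation cont open_Int op Bop that)
  qed
  then obtain D where D: "\<And>U V. U \<in> \<B> \<Longrightarrow> V \<in> \<B> \<Longrightarrow> U \<inter> V = {} \<Longrightarrow>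
      D U V \<in> sets borel \<and> f ` (?S \<inter> U) \<subseteq> D U V \<and> f ` (?S \<inter> V) \<inter> D U V = {}"
    unfolding borel_separated_def by metis
  \<comment> \<open>The differences make \<open>E U\<close> and \<open>E V\<close> disjoint for
    disjoint \<open>U\<close> and \<open>V\<close>; the closure later ties a point of
    \<open>E U\<close> to the values of \<open>f\<close> on \<open>U\<close>.\<close>
  define E where "E U = closure (f ` (?S \<inter> U)) \<inter> (\<Inter>V\<in>{V\<in>\<B>. U \<inter> V = {}}. D U V - D V U)" for U
  have E_borel: "E U \<in> sets borel" if "U \<in> \<B>" for U
  proof -
    have "(\<Inter>V\<in>{V\<in>\<B>. U \<inter> V = {}}. D U V - D V U) \<in> sets borel"
      using D that \<B>(1) by (intro sets.countable_INT'' sets.Diff) (auto simp: Int_commute)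
    then show ?thesis
      unfolding E_def by (intro sets.Int) auto
  qed
  have E_sup: "f ` (?S \<inter> U) \<subseteq> E U" if "U \<in> \<B>" for U
  proof -
    have "f ` (?S \<inter> U) \<subseteq> D U V - D V U" if "V \<in> \<B>" "U \<inter> V = {}" for V
      using D[of U V] D[of V U] \<open>U \<in> \<B>\<close> that by blast
    then show ?thesis
      unfolding E_def using closure_subset[of "f ` (?S \<inter> U)"] by (intro Int_greatest INT_greatest) auto
  qed
  have E_disj: "E U \<inter> E V = {}" if "U \<in> \<B>" "V \<in> \<B>" "U \<inter> V = {}" for U V
    using that unfolding E_def by (auto simp: Int_commute)
  define N where "N k = {U \<in> \<B>. closure U \<subseteq> S k \<and> (\<forall>x\<in>U. \<forall>y\<in>U. dist x y < 1 / Suc k)}" for k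
  have "f ` ?S = (\<Inter>k. \<Union>U\<in>N k. E U)"
  proof (intro equalityI subsetI INT_I)
    fix z k assume "z \<in> f ` ?S"
    then obtain p where p: "p \<in> ?S" "z = f p"
      by blast
    obtain \<V> where \<V>: "S k \<subseteq> \<Union>\<V>"
      "\<And>V. V \<in> \<V> \<Longrightarrow> open V \<and> closure V \<subseteq> S k \<and> (\<forall>x\<in>V. \<forall>y\<in>V. dist x y < 1 / Suc k)"
      using small_open_cover[OF op[of k], of "1 / Suc k"]
      by (metis of_nat_0_less_iff zero_less_Suc zero_less_divide_1_iff)
    then obtain V where V: "V \<in> \<V>" "p \<in> V"
      using p(1) by blast
    then obtain U where U: "U \<in> \<B>" "p \<in> U" "U \<subseteq> V"
      using topological_basisE[OF \<B>(2)] \<V>(2) by metis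
    then have "U \<in> N k"
      using \<V>(2)[OF V(1)] closure_mono[OF U(3)] unfolding N_def by blast
    then show "z \<in> (\<Union>U\<in>N k. E U)"
      using E_sup[OF U(1)] p U(2) by blast
  next
    fix z assume "z \<in> (\<Inter>k. \<Union>U\<in>N k. E U)"
    then have "\<forall>k. \<exists>U. U \<in> N k \<and> z \<in> E U"
      by blast
    then obtain U where U: "\<And>k. U k \<in> N k" "\<And>k. z \<in> E (U k)"
      by metis
    \<comment> \<open>Otherwise \<open>z\<close> would belong to two disjoint sets
      \<open>E (U j)\<close> and \<open>E (U k)\<close>.\<close>
    have "U j \<inter> U k \<noteq> {}" for j k
      using E_disj[of "U j" "U k"] U unfolding N_def by blast
    moreover have "dist x y < 1 / Suc k" if "x \<in> U k" "y \<in> U k" for k x y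
      using U(1)[of k] that unfolding N_def by blast
    ultimately obtain p where p: "\<And>k. p \<in> closure (U k)"
      "\<And>W. open W \<Longrightarrow> p \<in> W \<Longrightarrow> \<forall>\<^sub>F k in sequentially. U k \<subseteq> W"
      using meeting_small_sets_converge[of U] by metis
    have "p \<in> ?S"
      using p(1) U(1) unfolding N_def by blast
    moreover have "z = f p"
    proof (rule ccontr)
      assume "z \<noteq> f p"
      then obtain G H where GH: "open G" "open H" "z \<in> G" "f p \<in> H" "G \<inter> H = {}"
        using hausdorff by metis
      then have "\<forall>\<^sub>F k in sequentially. U k \<subseteq> f -` H"
        by (intro p(2) open_vimage[OF _ cont]) simp_all
      then obtain k where k: "U k \<subseteq> f -` H"
        by (auto simp: eventually_sequentially)
      \<comment> \<open>A late \<open>U k\<close> is mapped into \<open>H\<close>, so the closure of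
        the image misses \<open>G\<close>, although \<open>z\<close> belongs to both.\<close>
      have "closure (f ` (?S \<inter> U k)) \<subseteq> - G"
        by (rule closure_minimal) (use k GH in auto)
      moreover have "z \<in> closure (f ` (?S \<inter> U k))"
        using U(2)[of k] unfolding E_def by blast
      ultimately show False
        using GH(3) by blast
    qed
    ultimately show "z \<in> f ` ?S"
      by blast
  qed
  moreover have "(\<Inter>k. \<Union>U\<in>N k. E U) \<in> sets borel"
    using \<B>(1) E_borel by (intro sets.countable_INT' sets.countable_UN') (auto simp: N_def)
  ultimately show ?thesis
    by simp
qed

section \<open>Borel spans of independent \<open>G\<^sub>\<delta>\<close> sets\<close>

lemma ex_disjoint_basic_nhds:
  fixes F :: "'a::metric_space set"
  assumes "finite F" "topological_basis \<B>"
  obtains U where "\<And>x. x \<in> F \<Longrightarrow> x \<in> U x \<and> U x \<in> \<B>"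
    "\<And>x y. x \<in> F \<Longrightarrow> y \<in> F \<Longrightarrow> x \<noteq> y \<Longrightarrow> U x \<inter> U y = {}"
proof -
  obtain d where d: "\<And>x. 0 < d x" "\<And>x y. y \<in> F \<Longrightarrow> y \<noteq> x \<Longrightarrow> d x \<le> dist x y"
    using finite_set_avoid[OF assms(1)] by metis
  have "\<exists>U\<in>\<B>. x \<in> U \<and> U \<subseteq> ball x (d x / 2)" for x
    using topological_basisE[OF assms(2), of "ball x (d x / 2)" x] d(1)[of x] by force
  then obtain U where U: "\<And>x. U x \<in> \<B> \<and> x \<in> U x \<and> U x \<subseteq> ball x (d x / 2)"
    by metis
  have "U x \<inter> U y = {}" if "x \<in> F" "y \<in> F" "x \<noteq> y" for x y
  proof (rule equals0I)
    fix z assume "z \<in> U x \<inter> U y"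
    then have "dist x z < d x / 2" "dist y z < d y / 2"
      using U by (auto simp: subset_iff)
    moreover have "d x \<le> dist x y" "d y \<le> dist x y"
      using d(2)[of y x] d(2)[of x y] that by (auto simp: dist_commute)
    ultimately show False
      using dist_triangle2[of x y z] by linarith
  qed
  with U that show thesis
    by blast
qed

text \<open>By independence every vector of the span determines its summands with nonzero
  coefficients. Sorting the vectors by lists of disjoint basic neighbourhoods of these summands cuts
  the span into countably many pieces, each an injective continuous image of a
  \<open>G\<^sub>\<delta>\<close> set.\<close>

lemma span_borel:
  fixes Q :: "'a::{real_vector, complete_space, second_countable_topology, topological_ab_group_add} set"
    and S :: "nat \<Rightarrow> 'a set"
  assumes scale: "continuous_on UNIV (\<lambda>p :: real \<times> 'a. fst p *\<^sub>R snd p)"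
    and Q: "Q = (\<Inter>k. S k)" "\<And>k. open (S k)"
    and indep: "independent Q"
  shows "span Q \<in> sets borel"
proof -
  obtain \<B> :: "'a set set" where \<B>: "countable \<B>" "topological_basis \<B>"
    using ex_countable_basis by blast
  \<comment> \<open>Infinite sequences of pairs (coefficient, vector) provide one complete space for
    sums of any length; only the first \<open>r\<close> pairs count.\<close>
  define f where "f r p = (\<Sum>j<r. fst (p j) *\<^sub>R snd (p j))" for r :: nat and p :: "nat \<Rightarrow> real \<times> 'a"
  \<comment> \<open>Nonzero coefficients make each vector visible in the representation. The
    remaining pairs are pinned to \<open>(0, 0)\<close> by shrinking balls, since free values there
    would spoil injectivity.\<close>
  define D where "D Us j k = (if j < length Us
      then {p :: nat \<Rightarrow> real \<times> 'a. fst (p j) \<noteq> 0 \<and> snd (p j) \<in> S k \<inter> Us ! j}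
      else {p. dist (p j) (0, 0) < 1 / Suc k})"
    for Us :: "'a set list" and j k :: nat
  define G where "G Us = (\<Inter>n. case_prod (D Us) (prod_decode n))" for Us
  have lim0: "(\<forall>k. dist y (0, 0) < 1 / Suc k) \<longleftrightarrow> y = (0, 0)" for y :: "real \<times> 'a"
    using nat_approx_posE[of "dist y (0, 0)"] by (metis dist_self less_asym of_nat_0_less_iff
        zero_less_Suc zero_less_dist_iff zero_less_divide_1_iff)
  have G: "p \<in> G Us \<longleftrightarrow> (\<forall>j<length Us. fst (p j) \<noteq> 0 \<and> snd (p j) \<in> Q \<inter> Us ! j) \<and>
      (\<forall>j\<ge>length Us. p j = (0, 0))" for p Us
  proof -
    have "p \<in> G Us \<longleftrightarrow> (\<forall>j k. p \<in> D Us j k)"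
      unfolding G_def by (metis (no_types, lifting) INT_iff UNIV_I case_prod_conv prod_encode_inverse surj_pair)
    moreover have "(\<forall>k. p \<in> D Us j k) \<longleftrightarrow> fst (p j) \<noteq> 0 \<and> snd (p j) \<in> Q \<inter> Us ! j"
      if "j < length Us" for j
      using that by (auto simp: D_def Q(1))
    moreover have "(\<forall>k. p \<in> D Us j k) \<longleftrightarrow> p j = (0, 0)" if "length Us \<le> j" for j
      using that lim0[of "p j"] by (simp add: D_def del: of_nat_Suc)
    ultimately show ?thesis
      by (metis not_less)
  qed
  have coord: "continuous_on UNIV (\<lambda>p :: nat \<Rightarrow> real \<times> 'a. p j)" for j
    by simp
  have "open (D Us j k)" if "Us \<in> lists \<B>" for Us j k
  proof (cases "j < length Us")
    case True
    then have "open (Us ! j)"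
      using that topological_basis_open[OF \<B>(2)] by (auto simp: in_lists_conv_set)
    then have "open ((\<lambda>p :: nat \<Rightarrow> real \<times> 'a. fst (p j)) -` (- {0}) \<inter> (\<lambda>p. snd (p j)) -` (S k \<inter> Us ! j))"
      using Q(2) by (intro open_Int open_vimage continuous_on_fst continuous_on_snd coord) auto
    with True show ?thesis
      by (simp add: D_def vimage_def Int_def)
  next
    case False
    then have "D Us j k = (\<lambda>p. p j) -` ball (0, 0) (1 / Suc k)"
      unfolding D_def by (auto simp: dist_commute)
    then show ?thesis
      by (simp add: open_vimage[OF open_ball coord])
  qed
  then have op: "open (case_prod (D Us) (prod_decode n))" if "Us \<in> lists \<B>" for Us n
    using that by (simp add: case_prod_unfold)
  have cont: "continuous_on UNIV (f r)" for r
    unfolding f_def by (intro continuous_on_sum continuous_on_compose2[OF scale coord]) simp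
  \<comment> \<open>Disjoint neighbourhoods of the summands fix their order, which makes \<open>f\<close> injective.\<close>
  define disj where "disj Us \<longleftrightarrow> (\<forall>j<length Us. \<forall>k<length Us. j \<noteq> k \<longrightarrow> Us ! j \<inter> Us ! k = {})"
    for Us :: "'a set list"
  \<comment> \<open>The vectors may repeat here, in which case their coefficients add up.\<close>
  have rep: "representation Q (f (length Us) p) = (\<lambda>x. \<Sum>j<length Us. if x = snd (p j) then fst (p j) else 0)"
    if "p \<in> G Us" for p Us
  proof -
    have mem: "snd (p j) \<in> Q" if "j < length Us" for j
      using that G[of p Us] \<open>p \<in> G Us\<close> by blast
    have "representation Q (f (length Us) p) =
        (\<lambda>x. \<Sum>j<length Us. representation Q (fst (p j) *\<^sub>R snd (p j)) x)"
      unfolding f_def by (rule representation_sum[OF indep]) (simp add: mem span_base span_scale)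
    also have "\<dots> = (\<lambda>x. \<Sum>j<length Us. fst (p j) * (if x = snd (p j) then 1 else 0))"
      using mem by (intro ext sum.cong)
        (simp_all add: representation_scale[OF indep] representation_basis[OF indep] span_base)
    finally show ?thesis
      by (simp add: if_distrib cong: if_cong)
  qed
  have inj: "inj_on (f (length Us)) (G Us)" if "disj Us" for Us
  proof (rule inj_onI)
    fix p q assume pq: "p \<in> G Us" "q \<in> G Us" "f (length Us) p = f (length Us) q"
    have val: "representation Q (f (length Us) p') (snd (p' j)) = fst (p' j)"
      if "p' \<in> G Us" "j < length Us" for p' j
    proof -
      have "snd (p' j) \<noteq> snd (p' k)" if "k < length Us" "k \<noteq> j" for k
        using G[of p' Us] \<open>p' \<in> G Us\<close> \<open>j < length Us\<close> \<open>disj Us\<close> that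
        unfolding disj_def by (metis IntE disjoint_iff)
      then have "(\<Sum>k<length Us. if snd (p' j) = snd (p' k) then fst (p' k) else 0) =
          (\<Sum>k<length Us. if k = j then fst (p' j) else 0)"
        by (intro sum.cong) auto
      with that show ?thesis
        by (simp add: rep)
    qed
    have "p j = q j" if j: "j < length Us" for j
    proof -
      have "representation Q (f (length Us) q) (snd (p j)) \<noteq> 0"
        using val[OF pq(1) j] pq(3) G[of p Us] pq(1) j by simp
      \<comment> \<open>As \<open>snd (p j)\<close> has a nonzero coefficient in the second sum, it
        occurs there as some \<open>snd (q k)\<close>; disjointness of the neighbourhoods then
        forces \<open>k = j\<close>.\<close>
      then have "\<not> (\<forall>k\<in>{..<length Us}. (if snd (p j) = snd (q k) then fst (q k) else 0) = 0)"
        unfolding rep[OF pq(2)] by (rule contrapos_nn) (rule sum.neutral)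
      then obtain k where k: "k < length Us" "snd (p j) = snd (q k)"
        by (auto split: if_splits)
      then have "snd (p j) \<in> Us ! j \<inter> Us ! k"
        using G[of p Us] G[of q Us] pq j by auto
      then have "k = j"
        using \<open>disj Us\<close> j k(1) unfolding disj_def by blast
      then show ?thesis
        using k val[OF pq(1) j] val[OF pq(2) j] pq(3) by (simp add: prod_eq_iff)
    qed
    moreover have "p j = q j" if "\<not> j < length Us" for j
      using that G[of p Us] G[of q Us] pq by simp
    ultimately show "p = q"
      by blast
  qed
  have "span Q = (\<Union>Us\<in>{Us\<in>lists \<B>. disj Us}. f (length Us) ` G Us)"
  proof (intro equalityI subsetI)
    fix z assume z: "z \<in> span Q"
    define a where "a = representation Q z"
    define F where "F = {x. a x \<noteq> 0}"
    have F: "finite F" "F \<subseteq> Q" "z = (\<Sum>x\<in>F. a x *\<^sub>R x)"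
      using finite_representation[of Q z] representation_ne_zero[of Q z]
        sum_nonzero_representation_eq[OF indep z]
      by (auto simp: F_def a_def)
    obtain xs where xs: "set xs = F" "distinct xs"
      using finite_distinct_list[OF F(1)] by blast
    obtain U where U: "\<And>x. x \<in> F \<Longrightarrow> x \<in> U x \<and> U x \<in> \<B>"
      "\<And>x y. x \<in> F \<Longrightarrow> y \<in> F \<Longrightarrow> x \<noteq> y \<Longrightarrow> U x \<inter> U y = {}"
      using ex_disjoint_basic_nhds[OF F(1) \<B>(2)] by metis
    define p where "p j = (if j < length xs then (a (xs ! j), xs ! j) else (0, 0))" for j
    have "xs ! j \<in> F" if "j < length xs" for j
      using xs(1) that nth_mem by blast
    then have nth: "a (xs ! j) \<noteq> 0 \<and> xs ! j \<in> Q \<and> xs ! j \<in> U (xs ! j)" if "j < length xs" for j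
      using F(2) U(1) that unfolding F_def by blast
    have "p \<in> G (map U xs)"
      using nth unfolding G by (auto simp: p_def)
    moreover have "f (length (map U xs)) p = z"
    proof -
      have "f (length xs) p = (\<Sum>j<length xs. a (xs ! j) *\<^sub>R xs ! j)"
        unfolding f_def p_def by (intro sum.cong) auto
      also have "\<dots> = (\<Sum>x\<in>set xs. a x *\<^sub>R x)"
        using sum.reindex_bij_betw[OF bij_betw_nth[OF xs(2)], of "{..<length xs}" "set xs" "\<lambda>x. a x *\<^sub>R x"]
        by simp
      finally show ?thesis
        using F(3) xs(1) by simp
    qed
    moreover have "disj (map U xs)"
      unfolding disj_def length_map
    proof (intro allI impI)
      fix j k assume jk: "j < length xs" "k < length xs" "j \<noteq> k"
      then have "U (xs ! j) \<inter> U (xs ! k) = {}"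
        using xs nth_mem[of j xs] nth_mem[of k xs] by (intro U(2)) (auto simp: nth_eq_iff_index_eq)
      with jk show "map U xs ! j \<inter> map U xs ! k = {}"
        by simp
    qed
    moreover have "map U xs \<in> lists \<B>"
      using U(1) xs(1) by (auto simp: in_lists_conv_set)
    ultimately show "z \<in> (\<Union>Us\<in>{Us\<in>lists \<B>. disj Us}. f (length Us) ` G Us)"
      by blast
  next
    fix z assume "z \<in> (\<Union>Us\<in>{Us\<in>lists \<B>. disj Us}. f (length Us) ` G Us)"
    then obtain Us p where p: "p \<in> G Us" "z = f (length Us) p"
      by blast
    have "f (length Us) p \<in> span Q"
      unfolding f_def
    proof (rule span_sum)
      fix j assume "j \<in> {..<length Us}"
      then have "snd (p j) \<in> Q"
        using p(1) G[of p Us] by blast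
      then show "fst (p j) *\<^sub>R snd (p j) \<in> span Q"
        by (intro span_scale span_base)
    qed
    then show "z \<in> span Q"
      using p(2) by simp
  qed
  moreover have "f (length Us) ` G Us \<in> sets borel" if Us: "Us \<in> {Us\<in>lists \<B>. disj Us}" for Us
  proof -
    have "inj_on (f (length Us)) (\<Inter>n. case_prod (D Us) (prod_decode n))"
      using Us inj[of Us] by (simp add: G_def)
    with Us show ?thesis
      unfolding G_def by (intro lusin_souslin cont op) auto
  qed
  moreover have "countable {Us\<in>lists \<B>. disj Us}"
    using \<B>(1) by simp
  ultimately show ?thesis
    by (simp only:) (intro sets.countable_UN', auto)
qed

subsection \<open>Self-coding sequences\<close>

text \<open>The shift to \<open>Suc m\<close> avoids the coincidence \<open>fact 0 = fact 1\<close>;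
  from there on twice a factorial is at most the next one, which keeps the intervals
  disjoint.\<close>

definition spike :: "nat \<Rightarrow> real set"
  where "spike m = {fact (Suc m) <..< 2 * fact (Suc m)}"

text \<open>Only the first component of the pair coded by \<open>m\<close> names a list; the free
  second one supplies arbitrarily large codes of each list.\<close>

definition tag :: "nat \<Rightarrow> rat list"
  where "tag m = from_nat (fst (prod_decode m))"

definition tube :: "rat list \<Rightarrow> (nat \<Rightarrow> real) set"
  where "tube l = {x. \<forall>j<length l. \<bar>x j - of_rat (l ! j)\<bar> < 1 / 2 ^ length l}"

definition closed_tube :: "rat list \<Rightarrow> (nat \<Rightarrow> real) set"
  where "closed_tube l = {x. \<forall>j<length l. \<bar>x j - of_rat (l ! j)\<bar> \<le> 1 / 2 ^ length l}"

text \<open>The existence of a code is broken into countably many open conditions: spikes name tubes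
  around \<open>x\<close>, the lengths of the named lists never decrease, and these lengths are
  unbounded.\<close>

definition coding_stage :: "nat \<Rightarrow> (nat \<Rightarrow> real) set"
  where "coding_stage k =
    {x. \<exists>m\<ge>k. x k \<in> spike m \<and> x \<in> tube (tag m)} \<inter>
    {x. \<exists>m n. x k \<in> spike m \<and> x (Suc k) \<in> spike n \<and> length (tag m) \<le> length (tag n)} \<inter>
    {x. \<exists>i m. x i \<in> spike m \<and> k \<le> length (tag m)}"

definition self_coding :: "(nat \<Rightarrow> real) set"
  where "self_coding = (\<Inter>k. coding_stage k)"

definition code_of :: "(nat \<Rightarrow> real) \<Rightarrow> (nat \<Rightarrow> nat) \<Rightarrow> bool"
  where "code_of x \<mu> \<longleftrightarrow> (\<forall>i. i \<le> \<mu> i \<and> x i \<in> spike (\<mu> i) \<and> x \<in> tube (tag (\<mu> i))) \<and>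
    mono (\<lambda>i. length (tag (\<mu> i))) \<and> (\<forall>k. \<exists>i. k \<le> length (tag (\<mu> i)))"

lemma spike_unique:
  assumes "x \<in> spike m" "x \<in> spike n"
  shows "m = n"
proof -
  have "\<not> m < n" if "x \<in> spike m" "x \<in> spike n" for m n
  proof
    assume "m < n"
    then have "2 * fact (Suc m) \<le> (fact (Suc (Suc m)) :: real)" "fact (Suc (Suc m)) \<le> (fact (Suc n) :: real)"
      by (auto simp del: fact_Suc intro!: fact_mono) (simp add: algebra_simps)
    with that show False
      by (simp add: spike_def del: fact_Suc)
  qed
  with assms show ?thesis
    by (meson linorder_neqE_nat)
qed

text \<open>An entry lies in at most one spike, so the witnesses of the separate stages agree and
  form a single code.\<close>

lemma self_coding_iff: "x \<in> self_coding \<longleftrightarrow> (\<exists>\<mu>. code_of x \<mu>)"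
proof
  assume "x \<in> self_coding"
  then have x: "x \<in> coding_stage k" for k
    by (simp add: self_coding_def)
  then have "\<forall>i. \<exists>m\<ge>i. x i \<in> spike m \<and> x \<in> tube (tag m)"
    unfolding coding_stage_def by blast
  then obtain \<mu> where \<mu>: "\<And>i. i \<le> \<mu> i \<and> x i \<in> spike (\<mu> i) \<and> x \<in> tube (tag (\<mu> i))"
    by metis
  then have eq: "m = \<mu> i" if "x i \<in> spike m" for i m
    using spike_unique that by blast
  have "length (tag (\<mu> i)) \<le> length (tag (\<mu> (Suc i)))" for i
    using x[of i] eq unfolding coding_stage_def by blast
  then have "mono (\<lambda>i. length (tag (\<mu> i)))"
    by (rule mono_iff_le_Suc[THEN iffD2, rule_format])
  moreover have "\<exists>i. k \<le> length (tag (\<mu> i))" for k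
    using x[of k] eq unfolding coding_stage_def by blast
  ultimately show "\<exists>\<mu>. code_of x \<mu>"
    using \<mu> unfolding code_of_def by blast
next
  assume "\<exists>\<mu>. code_of x \<mu>"
  then obtain \<mu> where \<mu>: "code_of x \<mu>" ..
  have "length (tag (\<mu> k)) \<le> length (tag (\<mu> (Suc k)))" for k
    using \<mu> incseq_SucD[of "\<lambda>i. length (tag (\<mu> i))"] unfolding code_of_def by blast
  with \<mu> show "x \<in> self_coding"
    unfolding self_coding_def coding_stage_def code_of_def by blast
qed

lemma open_coordinate: "open X \<Longrightarrow> open {x :: nat \<Rightarrow> real. x i \<in> X}"
  using open_vimage[of X "\<lambda>x :: nat \<Rightarrow> real. x i"] by (simp add: vimage_def)

lemma open_tube: "open (tube l)"
proof -
  have "tube l = (\<Inter>j\<in>{..<length l}. {x. x j \<in> ball (of_rat (l ! j)) (1 / 2 ^ length l)})"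
    by (auto simp: tube_def dist_real_def abs_minus_commute)
  then show ?thesis
    by (simp only:) (intro open_INT ballI open_coordinate open_ball finite_lessThan)
qed

lemma closed_closed_tube: "closed (closed_tube l)"
proof -
  have "- closed_tube l = (\<Union>j\<in>{..<length l}. {x. x j \<in> - cball (of_rat (l ! j)) (1 / 2 ^ length l)})"
    by (auto simp: closed_tube_def dist_real_def abs_minus_commute)
  moreover have "open \<dots>"
    by (intro open_UN ballI open_coordinate) auto
  ultimately show ?thesis
    by (simp add: closed_def)
qed

lemma open_coding_stage: "open (coding_stage k)"
proof -
  have sp: "open {x :: nat \<Rightarrow> real. x i \<in> spike m}" for i m
    by (intro open_coordinate) (simp add: spike_def)
  show ?thesis
    unfolding coding_stage_def
    by (intro open_Int open_Collect_ex open_Collect_conj open_Collect_const sp)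
       (simp_all add: open_tube)
qed

text \<open>Sequences sharing a code at a late index lie in the same tube, whose width is by then
  smaller than their gap at some coordinate.\<close>

lemma distinct_codes:
  assumes "code_of x \<mu>" "code_of y \<nu>" "x \<noteq> y"
  shows "\<forall>\<^sub>F i in sequentially. \<mu> i \<noteq> \<nu> i"
proof -
  obtain j where "x j \<noteq> y j"
    using assms(3) by blast
  \<comment> \<open>No tube of a list of length at least \<open>k\<close> holds both sequences: it
    restricts coordinate \<open>j\<close> and has width at most \<open>2 / 2 ^ k\<close>.\<close>
  then obtain k where k: "2 / 2 ^ k < \<bar>x j - y j\<bar>" "j < k"
  proof -
    have "(\<lambda>k. 2 / 2 ^ k :: real) \<longlonglongrightarrow> 0"
      by real_asymp
    then have "\<forall>\<^sub>F k in sequentially. 2 / 2 ^ k < \<bar>x j - y j\<bar>"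
      using \<open>x j \<noteq> y j\<close> by (intro order_tendstoD(2)) auto
    then have "\<forall>\<^sub>F k in sequentially. 2 / 2 ^ k < \<bar>x j - y j\<bar> \<and> j < k"
      by (intro eventually_conj eventually_gt_at_top)
    then show thesis
      using that by (auto simp: eventually_sequentially)
  qed
  obtain i0 where i0: "k \<le> length (tag (\<mu> i0))"
    using assms(1) unfolding code_of_def by blast
  have "\<mu> i \<noteq> \<nu> i" if "i0 \<le> i" for i
  proof
    assume eq: "\<mu> i = \<nu> i"
    define l where "l = tag (\<mu> i)"
    have "k \<le> length l"
      using assms(1) i0 that incseqD[of "\<lambda>i. length (tag (\<mu> i))" i0 i]
      unfolding code_of_def l_def by linarith
    moreover have "x \<in> tube l" "y \<in> tube l"
      using assms(1,2) eq unfolding code_of_def l_def by metis+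
    ultimately have "\<bar>x j - of_rat (l ! j)\<bar> < 1 / 2 ^ length l" "\<bar>y j - of_rat (l ! j)\<bar> < 1 / 2 ^ length l"
      using k(2) by (auto simp: tube_def)
    moreover have "1 / 2 ^ length l \<le> (1 / 2 ^ k :: real)"
      using \<open>k \<le> length l\<close> by (simp add: field_simps)
    ultimately show False
      using k(1) by linarith
  qed
  then show ?thesis
    by (auto simp: eventually_sequentially)
qed

section \<open>Unboundedness of linear combinations\<close>

text \<open>At a late index all codes differ and the summand with the largest code \<open>M\<close>
  dominates: in modulus it is at least \<open>c * fact (Suc M)\<close>, while the others together
  are at most \<open>2 * A * fact M\<close>. The excess
  \<open>fact M * (c * (M + 1) - 2 * A)\<close> outgrows every bound.\<close>

lemma bounded_combination_trivial:
  fixes a :: "(nat \<Rightarrow> real) \<Rightarrow> real"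
  assumes "finite F" "F \<subseteq> self_coding" and bound: "\<And>i. \<bar>\<Sum>x\<in>F. a x * x i\<bar> \<le> b"
    and "x \<in> F"
  shows "a x = 0"
proof (rule ccontr)
  assume "a x \<noteq> 0"
  \<comment> \<open>Zero coefficients are dropped so that the least modulus \<open>c\<close> is
    positive.\<close>
  define E where "E = {x\<in>F. a x \<noteq> 0}"
  have E: "finite E" "E \<subseteq> self_coding" "E \<noteq> {}"
    using assms \<open>a x \<noteq> 0\<close> by (auto simp: E_def)
  have sumE: "(\<Sum>x\<in>F. a x * x i) = (\<Sum>x\<in>E. a x * x i)" for i
    unfolding E_def by (rule sum.mono_neutral_right) (use assms(1) in auto)
  obtain \<mu> where \<mu>: "\<And>x. x \<in> E \<Longrightarrow> code_of x (\<mu> x)"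
    using E(2) self_coding_iff by (metis subsetD)
  define c where "c = Min ((\<lambda>x. \<bar>a x\<bar>) ` E)"
  define A where "A = (\<Sum>x\<in>E. \<bar>a x\<bar>)"
  have c: "0 < c" "\<And>x. x \<in> E \<Longrightarrow> c \<le> \<bar>a x\<bar>"
    using E unfolding c_def by (auto simp: E_def)
  have "\<forall>\<^sub>F i in sequentially. \<forall>x\<in>E. \<forall>y\<in>E. x \<noteq> y \<longrightarrow> \<mu> x i \<noteq> \<mu> y i"
  proof (intro eventually_ball_finite ballI E(1))
    fix x y assume "x \<in> E" "y \<in> E"
    then show "\<forall>\<^sub>F i in sequentially. x \<noteq> y \<longrightarrow> \<mu> x i \<noteq> \<mu> y i"
      using distinct_codes[OF \<mu> \<mu>, of x y] by (cases "x = y") simp_all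
  qed
  \<comment> \<open>As a code is at least its index, this makes \<open>c * (M + 1) - 2 * A\<close>
    at least \<open>b + 1\<close>.\<close>
  moreover have "\<forall>\<^sub>F i in sequentially. (b + 2 * A + 1) / c \<le> real i"
    using eventually_ge_at_top[of "nat \<lceil>(b + 2 * A + 1) / c\<rceil>"] by eventually_elim linarith
  ultimately have "\<forall>\<^sub>F i in sequentially. (\<forall>x\<in>E. \<forall>y\<in>E. x \<noteq> y \<longrightarrow> \<mu> x i \<noteq> \<mu> y i) \<and>
      (b + 2 * A + 1) / c \<le> real i"
    by (rule eventually_conj)
  then obtain i where
    i: "\<And>x y. x \<in> E \<Longrightarrow> y \<in> E \<Longrightarrow> x \<noteq> y \<Longrightarrow> \<mu> x i \<noteq> \<mu> y i" "(b + 2 * A + 1) / c \<le> real i"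
    by (auto simp: eventually_sequentially)
  \<comment> \<open>The name \<open>x\<close> is now reused for the summand with the largest code at
    index \<open>i\<close>.\<close>
  have "Max ((\<lambda>y. \<mu> y i) ` E) \<in> (\<lambda>y. \<mu> y i) ` E"
    using E(1,3) by (intro Max_in) auto
  then obtain x where x: "x \<in> E" "\<mu> x i = Max ((\<lambda>y. \<mu> y i) ` E)"
    by (metis imageE)
  then have top: "\<mu> y i \<le> \<mu> x i" if "y \<in> E" for y
    using E(1) that by simp
  define M where "M = \<mu> x i"
  have "i \<le> M"
    using \<mu>[OF x(1)] unfolding code_of_def M_def by blast
  have xi: "fact (Suc M) < x i"
    using \<mu>[OF x(1)] unfolding code_of_def M_def spike_def by auto
  have yi: "\<bar>y i\<bar> \<le> 2 * fact M" if "y \<in> E - {x}" for y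
  proof -
    have "Suc (\<mu> y i) \<le> M"
      using top[of y] i(1)[of y x] x(1) that unfolding M_def by force
    then have "fact (Suc (\<mu> y i)) \<le> (fact M :: real)"
      by (rule fact_mono)
    moreover have "y i \<in> spike (\<mu> y i)"
      using \<mu>[of y] that unfolding code_of_def by blast
    moreover have "0 < (fact (Suc (\<mu> y i)) :: real)"
      by simp
    ultimately show ?thesis
      by (simp add: spike_def del: fact_Suc)
  qed
  have "\<bar>\<Sum>y\<in>E - {x}. a y * y i\<bar> \<le> (\<Sum>y\<in>E - {x}. \<bar>a y * y i\<bar>)"
    by (rule sum_abs)
  also have "\<dots> \<le> (\<Sum>y\<in>E - {x}. \<bar>a y\<bar> * (2 * fact M))"
    using yi by (intro sum_mono) (simp add: abs_mult mult_left_mono)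
  also have "\<dots> \<le> A * (2 * fact M)"
    unfolding A_def sum_distrib_right using E(1) by (intro sum_mono2) auto
  finally have rest: "\<bar>\<Sum>y\<in>E - {x}. a y * y i\<bar> \<le> A * (2 * fact M)" .
  have "c * fact (Suc M) \<le> \<bar>a x\<bar> * x i"
    using xi c x(1) by (intro mult_mono) auto
  also have "\<dots> = \<bar>a x * x i\<bar>"
    using order.strict_trans[OF fact_gt_zero xi] by (simp add: abs_mult)
  finally have "c * fact (Suc M) - A * (2 * fact M) \<le> \<bar>\<Sum>y\<in>E. a y * y i\<bar>"
    using rest E(1) x(1) by (simp add: sum.remove[of E x])
  then have le: "fact M * (c * (real M + 1) - 2 * A) \<le> b"
    using bound[of i, unfolded sumE] by (simp add: algebra_simps)
  have "b + 1 \<le> c * (real M + 1) - 2 * A"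
  proof -
    have "b + 2 * A + 1 \<le> c * real i"
      using i(2) c(1) by (simp add: field_simps)
    also have "\<dots> \<le> c * (real M + 1)"
      using \<open>i \<le> M\<close> c(1) by simp
    finally show ?thesis
      by simp
  qed
  moreover have "0 \<le> b"
    using bound[of 0] by linarith
  ultimately have "1 * (b + 1) \<le> fact M * (c * (real M + 1) - 2 * A)"
    using fact_ge_1[of M, where ?'a = real] by (intro mult_mono) auto
  from order_trans[OF this le] show False
    by simp
qed

lemma sum_scaleR_apply:
  fixes f :: "'a \<Rightarrow> nat \<Rightarrow> real"
  shows "(\<Sum>x\<in>F. a x *\<^sub>R f x) i = (\<Sum>x\<in>F. a x *\<^sub>R f x i)"
proof (induction F rule: infinite_finite_induct)
  case (insert x F)
  then show ?case
    by (simp add: scaleR_fun_def[of "a x" "f x"])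
qed simp_all

lemma independent_self_coding: "independent self_coding"
proof
  assume "dependent self_coding"
  then obtain F a x where F: "finite F" "F \<subseteq> self_coding" "x \<in> F" "a x \<noteq> 0" "(\<Sum>x\<in>F. a x *\<^sub>R x) = 0"
    unfolding dependent_explicit by blast
  have "(\<Sum>x\<in>F. a x * x i) = 0" for i
    using fun_cong[OF F(5), of i] by (simp add: sum_scaleR_apply)
  then show False
    using bounded_combination_trivial[OF F(1,2) _ F(3), of a 0] F(4) by simp
qed

text \<open>This is the discreteness that, for \<open>b = 1\<close>, yields both kinds of
  Haar-smallness.\<close>

lemma bounded_span_self_coding:
  assumes "z \<in> span self_coding" "\<And>i. \<bar>z i\<bar> \<le> b"
  shows "z = 0"
proof -
  obtain F a where F: "finite F" "F \<subseteq> self_coding" "z = (\<Sum>x\<in>F. a x *\<^sub>R x)"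
    using assms(1) unfolding span_explicit by blast
  then have "\<bar>\<Sum>x\<in>F. a x * x i\<bar> \<le> b" for i
    using assms(2)[of i] by (simp add: sum_scaleR_apply)
  then have "a x = 0" if "x \<in> F" for x
    using bounded_combination_trivial[OF F(1,2) _ that] by blast
  then show ?thesis
    using F(3) by simp
qed

subsection \<open>Haar-smallness of discrete subspaces\<close>

text \<open>Flipping ever later digits of \<open>c\<close> gives points different from
  \<open>c\<close> that converge to it.\<close>

lemma cantor_point_not_isolated:
  fixes c :: "nat \<Rightarrow> bool"
  assumes "open W" "c \<in> W"
  shows "\<exists>c'\<in>W. c' \<noteq> c"
proof -
  have "(\<lambda>n. c(n := \<not> c n)) \<longlonglongrightarrow> c"
    unfolding tendsto_fun_iff
  proof
    fix i
    have "\<forall>\<^sub>F n in sequentially. (c(n := \<not> c n)) i = c i"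
      using eventually_gt_at_top[of i] by eventually_elim simp
    then show "(\<lambda>n. (c(n := \<not> c n)) i) \<longlonglongrightarrow> c i"
      by (rule tendsto_eventually)
  qed
  then obtain n where "c(n := \<not> c n) \<in> W"
    using topological_tendstoD[OF _ assms] by (force simp: eventually_sequentially)
  then show ?thesis
    by (intro bexI[of _ "c(n := \<not> c n)"]) (simp_all add: fun_upd_same fun_eq_iff)
qed

lemma Hausdorff_space_cantor: "Hausdorff_space (euclidean :: (nat \<Rightarrow> bool) topology)"
proof -
  have "Hausdorff_space (euclidean :: bool topology)"
    unfolding Hausdorff_space_def
  proof (intro allI impI)
    fix x y :: bool assume "x \<in> topspace euclidean \<and> y \<in> topspace euclidean \<and> x \<noteq> y"
    then show "\<exists>U V. openin euclidean U \<and> openin euclidean V \<and> x \<in> U \<and> y \<in> V \<and> disjnt U V"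
      by (rule_tac exI[of _ "{x}"], rule_tac exI[of _ "{y}"]) (simp add: Topological_Spaces.open_discrete)
  qed
  then show ?thesis
    unfolding euclidean_product_topology[symmetric] Hausdorff_space_product_topology by simp
qed

lemma compact_space_cantor: "compact_space (euclidean :: (nat \<Rightarrow> bool) topology)"
proof -
  have "compact_space (euclidean :: bool topology)"
    by (simp add: compact_space_def finite_imp_compact)
  then show ?thesis
    unfolding euclidean_product_topology[symmetric] compact_space_product_topology by simp
qed

lemma meager_cantor_subsingleton:
  fixes X :: "(nat \<Rightarrow> bool) set"
  assumes "\<And>c c'. c \<in> X \<Longrightarrow> c' \<in> X \<Longrightarrow> c = c'"
  shows "meager X"
proof -
  have "finite X"
    using assms by (metis finite.simps is_singletonI' is_singleton_the_elem)
  then have "closed X"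
    using closedin_Hausdorff_finite[OF Hausdorff_space_cantor, of X] by simp
  moreover have "interior X = {}"
  proof (rule equals0I)
    fix c assume c: "c \<in> interior X"
    then obtain c' where "c' \<in> interior X" "c' \<noteq> c"
      using cantor_point_not_isolated[OF open_interior] by blast
    with c show False
      using assms interior_subset by blast
  qed
  ultimately show ?thesis
    unfolding meager_def nowhere_dense_def by (intro exI[of _ "\<lambda>_. X"]) simp
qed

text \<open>Baire's theorem in the compact Hausdorff cube. It turns Haar-meagerness into the absence
  of nonempty open sets in the preimages of translates.\<close>

lemma interior_meager_cantor:
  fixes X :: "(nat \<Rightarrow> bool) set"
  assumes "meager X"
  shows "interior X = {}"
proof -
  obtain N where N: "\<And>n. interior (closure (N n)) = {}" "X = (\<Union>n::nat. N n)"
    using assms unfolding meager_def nowhere_dense_def by blast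
  have "locally_compact_space (euclidean :: (nat \<Rightarrow> bool) topology)"
    "regular_space (euclidean :: (nat \<Rightarrow> bool) topology)"
    using compact_space_cantor Hausdorff_space_cantor
    by (auto intro: compact_imp_locally_compact_space compact_Hausdorff_imp_regular_space)
  then have "euclidean interior_of \<Union> (range (\<lambda>n. closure (N n))) = {}"
    using N(1) by (intro Baire_category_alt disjI2 conjI) auto
  then have "interior (\<Union>n. closure (N n)) = {}"
    by simp
  then show ?thesis
    using interior_mono[of X "\<Union>n. closure (N n)"] N(2) closure_subset by fast
qed

lemma translate_iff: "y \<in> (\<lambda>a. a + x) ` L \<longleftrightarrow> y - x \<in> (L :: 'a::ab_group_add set)"
proof
  assume "y - x \<in> L"
  then show "y \<in> (\<lambda>a. a + x) ` L"
    by (rule rev_image_eqI) simp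
qed auto

text \<open>Subtraction cancels the translation: \<open>y - y'\<close> lies in \<open>L\<close> and,
  as both points are in the unit cube, has entries of modulus at most 1.\<close>

lemma subspace_translate_unique:
  fixes L :: "(nat \<Rightarrow> real) set"
  assumes "subspace L" and disc: "\<And>z. z \<in> L \<Longrightarrow> (\<And>i. \<bar>z i\<bar> \<le> 1) \<Longrightarrow> z = 0"
    and "y \<in> (\<lambda>a. a + x) ` L" "y' \<in> (\<lambda>a. a + x) ` L"
    and "\<And>i. y i \<in> {0..1}" "\<And>i. y' i \<in> {0..1}"
  shows "y = y'"
proof -
  have "(y - x) - (y' - x) \<in> L"
    using assms(1,3,4) by (simp only: translate_iff subspace_diff)
  then have "y - y' \<in> L"
    by simp
  moreover have "\<bar>(y - y') i\<bar> \<le> 1" for i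
    using assms(5)[of i] assms(6)[of i] by auto
  ultimately show ?thesis
    using disc[of "y - y'"] by simp
qed

text \<open>The inclusion of the Cantor cube into the unit cube is a witness, as preimages of
  translates have at most one point.\<close>

lemma haar_meager_discrete:
  fixes L :: "(nat \<Rightarrow> real) set"
  assumes "L \<in> sets borel" "subspace L" and disc: "\<And>z. z \<in> L \<Longrightarrow> (\<And>i. \<bar>z i\<bar> \<le> 1) \<Longrightarrow> z = 0"
  shows "haar_meager L"
proof -
  define f where "f c = (\<lambda>i. of_bool (c i) :: real)" for c :: "nat \<Rightarrow> bool"
  have "continuous_on UNIV (\<lambda>c :: nat \<Rightarrow> bool. of_bool (c i) :: real)" for i
    using continuous_on_compose[of UNIV "\<lambda>c :: nat \<Rightarrow> bool. c i" "of_bool :: bool \<Rightarrow> real"]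
    by (simp add: o_def)
  then have "continuous_on UNIV f"
    unfolding f_def by (intro continuous_on_coordinatewise_then_product)
  moreover have "meager (f -` ((\<lambda>a. a + x) ` L))" for x
  proof (rule meager_cantor_subsingleton)
    fix c c' assume "c \<in> f -` ((\<lambda>a. a + x) ` L)" "c' \<in> f -` ((\<lambda>a. a + x) ` L)"
    then have "f c = f c'"
      using subspace_translate_unique[OF assms(2) disc, of "f c" x "f c'"] by (simp add: f_def)
    then have eq: "of_bool (c i) = (of_bool (c' i) :: real)" for i
      unfolding f_def by (rule fun_cong)
    show "c = c'"
    proof
      show "c i = c' i" for i
        using eq[of i] by (cases "c i"; cases "c' i") simp_all
    qed
  qed
  ultimately show ?thesis
    using assms(1) unfolding haar_meager_def by blast
qed

text \<open>The uniform measure on the diagonal segment of the unit cube is a witness: it has no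
  atoms, and a translate of \<open>L\<close> meets the segment in at most one point.\<close>

lemma haar_null_discrete:
  fixes L :: "(nat \<Rightarrow> real) set"
  assumes "L \<in> sets borel" "subspace L" and disc: "\<And>z. z \<in> L \<Longrightarrow> (\<And>i. \<bar>z i\<bar> \<le> 1) \<Longrightarrow> z = 0"
  shows "haar_null L"
proof -
  define h where "h t = (\<lambda>i::nat. t)" for t :: real
  define U where "U = uniform_measure lborel {0..1::real}"
  have h: "h \<in> borel_measurable borel"
    unfolding h_def
    by (intro borel_measurable_continuous_onI continuous_on_coordinatewise_then_product continuous_on_id)
  then have hU: "h \<in> U \<rightarrow>\<^sub>M borel"
    by (simp add: U_def cong: measurable_cong_sets)
  have "prob_space U"
    unfolding U_def by (rule prob_space_uniform_measure) simp_all
  then have "prob_space (distr U borel h)"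
    using hU by (rule prob_space.prob_space_distr)
  moreover have "emeasure (distr U borel h) ((\<lambda>a. a + x) ` L) = 0" for x
  proof -
    let ?T = "(\<lambda>a. a + x) ` L"
    have T: "?T \<in> sets borel"
      by (rule borel_translate[OF assms(1)])
    then have pre: "h -` ?T \<in> sets lborel"
      using measurable_sets[OF h T] by simp
    have "t = t'" if "t \<in> {0..1} \<inter> h -` ?T" "t' \<in> {0..1} \<inter> h -` ?T" for t t'
      using subspace_translate_unique[OF assms(2) disc, of "h t" x "h t'"] that
      by (auto simp: h_def dest: fun_cong)
    then have "finite ({0..1} \<inter> h -` ?T)"
      by (metis finite.simps is_singletonI' is_singleton_the_elem)
    then have "emeasure lborel ({0..1} \<inter> h -` ?T) = 0"
      by (intro emeasure_lborel_countable countable_finite)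
    then have "emeasure U (h -` ?T) = 0"
      unfolding U_def using pre by simp
    then show ?thesis
      using hU T by (simp add: emeasure_distr) (simp add: U_def)
  qed
  ultimately show ?thesis
    using assms(1) unfolding haar_null_def by (intro conjI exI[of _ "distr U borel h"]) auto
qed

subsection \<open>Escaping closed Haar-meager sets\<close>

lemma ex_large_code: "\<exists>m\<ge>N. tag m = l"
proof (intro exI conjI)
  show "N \<le> prod_encode (to_nat l, N)"
    by (rule le_prod_encode_2)
  show "tag (prod_encode (to_nat l, N)) = l"
    unfolding tag_def prod_encode_inverse fst_conv by (rule from_nat_to_nat)
qed

text \<open>Otherwise \<open>C\<close> would contain all points of the tube with such spikes. A
  translate of the image of a witness map \<open>f\<close> fits into spikes, since compactness
  bounds each coordinate of \<open>f\<close>, and near one point of the cube it fits into the tube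
  as well. So \<open>f\<close> would map a nonempty open set into a translate of \<open>C\<close>,
  against Baire.\<close>

lemma ex_spikes_avoiding_haar_meager:
  fixes C :: "(nat \<Rightarrow> real) set"
  assumes "closed C" "haar_meager C"
  obtains p \<nu> where "p \<in> tube l" "p \<notin> C"
    "\<And>i. length l \<le> i \<Longrightarrow> i \<le> \<nu> i \<and> tag (\<nu> i) = l \<and> p i - 1 \<in> spike (\<nu> i) \<and> p i + 1 \<in> spike (\<nu> i)"
proof (rule ccontr)
  assume "\<not> thesis"
  with that have neg: "\<not> (p \<in> tube l \<and> p \<notin> C \<and> (\<forall>i\<ge>length l. i \<le> \<nu> i \<and> tag (\<nu> i) = l \<and>
      p i - 1 \<in> spike (\<nu> i) \<and> p i + 1 \<in> spike (\<nu> i)))" for p \<nu>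
    by blast
  obtain f :: "(nat \<Rightarrow> bool) \<Rightarrow> nat \<Rightarrow> real" where
    f: "continuous_on UNIV f" "\<And>x. meager (f -` ((\<lambda>a. a + x) ` C))"
    using assms(2) unfolding haar_meager_def by blast
  have fi: "continuous_on UNIV (\<lambda>c. f c i)" for i
    using f(1) by (rule continuous_on_product_then_coordinatewise)
  have "\<exists>b. \<forall>c. \<bar>f c i\<bar> \<le> b" for i
  proof -
    have "compact (UNIV :: (nat \<Rightarrow> bool) set)"
      using compact_space_cantor by (simp add: compact_space_def)
    then have "bounded (range (\<lambda>c. f c i))"
      by (intro compact_imp_bounded compact_continuous_image fi)
    then show ?thesis
      by (auto simp: bounded_iff)
  qed
  then obtain b where b: "\<And>i c. \<bar>f c i\<bar> \<le> b i"
    by metis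
  \<comment> \<open>The spike has length \<open>fact (Suc m)\<close>, more than
    \<open>2 * (b i + 1)\<close>: around its midpoint there is room for the range of coordinate
    \<open>i\<close> and a margin 1 on each side.\<close>
  have "\<exists>m. i \<le> m \<and> 2 * b i + 2 < real m \<and> tag m = l" for i
    using ex_large_code[of "max i (nat \<lceil>2 * b i + 3\<rceil>)" l] by (smt (verit) max.bounded_iff of_nat_ceiling of_nat_mono)
  then obtain \<nu> where \<nu>: "\<And>i. i \<le> \<nu> i \<and> 2 * b i + 2 < real (\<nu> i) \<and> tag (\<nu> i) = l"
    by metis
  define c0 :: "nat \<Rightarrow> bool" where "c0 = (\<lambda>_. False)"
  \<comment> \<open>The first coordinates move \<open>f c0\<close> to the centre of the tube; the
    others move 0 to the midpoint of a spike.\<close>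
  define t where "t i = (if i < length l then of_rat (l ! i) - f c0 i else 3 / 2 * fact (Suc (\<nu> i)))" for i
  define W where "W = {c. f c + t \<in> tube l}"
  have ft: "continuous_on UNIV (\<lambda>c. f c + t)"
    by (intro continuous_on_add f(1) continuous_on_const)
  have "open W"
    using open_vimage[OF open_tube ft] by (simp add: W_def vimage_def)
  have "c0 \<in> W"
    by (simp add: W_def tube_def t_def)
  have "f c + t \<in> C" if "c \<in> W" for c
  proof (rule ccontr)
    assume "f c + t \<notin> C"
    moreover have "(f c + t) i - 1 \<in> spike (\<nu> i) \<and> (f c + t) i + 1 \<in> spike (\<nu> i)" if "length l \<le> i" for i
    proof -
      have "real (Suc (\<nu> i)) \<le> real (fact (Suc (\<nu> i)))"
        by (intro of_nat_mono fact_ge_self)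
      then have "2 * b i + 2 < fact (Suc (\<nu> i))"
        using \<nu>[of i] by (simp only: of_nat_fact of_nat_Suc) linarith
      then show ?thesis
        using b[of c i] that by (simp add: t_def spike_def abs_le_iff del: fact_Suc)
    qed
    ultimately show False
      using neg[of "f c + t" \<nu>] \<open>c \<in> W\<close> \<nu> unfolding W_def by blast
  qed
  then have "W \<subseteq> f -` ((\<lambda>a. a + (- t)) ` C)"
    by (simp add: subset_iff translate_iff del: image_add_0 add_uminus_conv_diff)
  then have "W \<subseteq> interior (f -` ((\<lambda>a. a + (- t)) ` C))"
    using \<open>open W\<close> by (rule interior_maximal)
  then show False
    using interior_meager_cantor[OF f(2)] \<open>c0 \<in> W\<close> by blast
qed

section \<open>Nested tubes and the escaping sequence\<close>

text \<open>Points violating the claim for infinitely many \<open>n\<close> would converge to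
  \<open>p\<close> coordinatewise and yet avoid \<open>V\<close>. The radius
  \<open>2 / 2 ^ n\<close> allows for a tube whose centre is within \<open>1 / 2 ^ n\<close> of
  \<open>p\<close>.\<close>

lemma open_sequence_nhd:
  fixes V :: "(nat \<Rightarrow> real) set"
  assumes "open V" "p \<in> V"
  shows "\<forall>\<^sub>F n in sequentially. \<forall>y. (\<forall>j<n. \<bar>y j - p j\<bar> < 2 / 2 ^ n) \<longrightarrow> y \<in> V"
proof -
  define bad where "bad n y \<longleftrightarrow> (\<forall>j<n. \<bar>y j - p j\<bar> < 2 / 2 ^ n) \<and> y \<notin> V" for n y
  define y where "y n = (if \<exists>y. bad n y then SOME y. bad n y else p)" for n
  have bad: "bad n (y n)" if "bad n z" for n z
    using someI[of "bad n", OF that] that by (auto simp: y_def)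
  have close: "\<bar>y n j - p j\<bar> < 2 / 2 ^ n" if "j < n" for j n
    using bad[of n] that by (cases "\<exists>z. bad n z") (auto simp: bad_def y_def)
  have "(\<lambda>n. 2 / 2 ^ n :: real) \<longlonglongrightarrow> 0"
    by real_asymp
  then have "(\<lambda>n. y n j - p j) \<longlonglongrightarrow> 0" for j
  proof (rule Lim_null_comparison[rotated])
    show "\<forall>\<^sub>F n in sequentially. norm (y n j - p j) \<le> 2 / 2 ^ n"
      using eventually_gt_at_top[of j]
    proof eventually_elim
      case (elim n)
      have "\<bar>y n j - p j\<bar> < 2 / 2 ^ n"
        using elim by (rule close)
      then show ?case
        unfolding real_norm_def by (rule less_imp_le)
    qed
  qed
  then have "y \<longlonglongrightarrow> p"
    unfolding tendsto_fun_iff by (auto intro: LIM_zero_cancel)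
  then have "\<forall>\<^sub>F n in sequentially. y n \<in> V"
    using assms by (rule topological_tendstoD)
  then show ?thesis
  proof eventually_elim
    case (elim n)
    then have "\<not> bad n z" for z
      using bad[of n z] unfolding bad_def by blast
    then show ?case
      unfolding bad_def by blast
  qed
qed

text \<open>One stage of a fusion: every coordinate added by \<open>l'\<close> is spent on a spike
  naming the old list \<open>l\<close>, the same spike for all points of the new closed
  tube.\<close>

definition refines :: "(nat \<Rightarrow> real) set \<Rightarrow> rat list \<Rightarrow> rat list \<Rightarrow> bool"
  where "refines C l l' \<longleftrightarrow> length l < length l' \<and> closed_tube l' \<subseteq> tube l - C \<and>
    (\<exists>\<nu>. \<forall>i. length l \<le> i \<and> i < length l' \<longrightarrow>
      i \<le> \<nu> i \<and> tag (\<nu> i) = l \<and> (\<forall>x\<in>closed_tube l'. x i \<in> spike (\<nu> i)))"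

text \<open>A long list of rationals close to \<open>p\<close> has a closed tube so small that it
  stays in \<open>tube l\<close>, off \<open>C\<close>, and within the margin 1 of the
  spikes.\<close>

lemma ex_refinement:
  assumes "closed C" "haar_meager C"
  shows "\<exists>l'. refines C l l'"
proof -
  obtain p \<nu> where p: "p \<in> tube l" "p \<notin> C" and
    \<nu>: "\<And>i. length l \<le> i \<Longrightarrow> i \<le> \<nu> i \<and> tag (\<nu> i) = l \<and> p i - 1 \<in> spike (\<nu> i) \<and> p i + 1 \<in> spike (\<nu> i)"
    using ex_spikes_avoiding_haar_meager[OF assms] by metis
  have "open (tube l - C)"
    using assms(1) open_tube by blast
  then have "\<forall>\<^sub>F n in sequentially. (\<forall>y. (\<forall>j<n. \<bar>y j - p j\<bar> < 2 / 2 ^ n) \<longrightarrow> y \<in> tube l - C) \<and> length l < n"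
    using p by (intro eventually_conj open_sequence_nhd eventually_gt_at_top) auto
  then obtain n where n: "\<And>y. (\<And>j. j < n \<Longrightarrow> \<bar>y j - p j\<bar> < 2 / 2 ^ n) \<Longrightarrow> y \<in> tube l - C" "length l < n"
    by (auto simp: eventually_sequentially)
  have "\<exists>q. \<bar>p j - of_rat q\<bar> < 1 / 2 ^ n" for j
  proof -
    obtain q where "p j - 1 / 2 ^ n < of_rat q" "of_rat q < p j"
      using of_rat_dense[of "p j - 1 / 2 ^ n" "p j"] by auto
    then show ?thesis
      by (intro exI[of _ q]) linarith
  qed
  then obtain q where q: "\<And>j. \<bar>p j - of_rat (q j)\<bar> < 1 / 2 ^ n"
    by metis
  define l' where "l' = map q [0..<n]"
  have near: "\<bar>y j - p j\<bar> < 2 / 2 ^ n" if "y \<in> closed_tube l'" "j < n" for y j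
  proof -
    have "\<bar>y j - of_rat (q j)\<bar> \<le> 1 / 2 ^ n"
      using that by (simp add: closed_tube_def l'_def)
    then show ?thesis
      using q[of j] by (simp add: field_simps abs_le_iff abs_less_iff)
  qed
  have "closed_tube l' \<subseteq> tube l - C"
    using near n(1) by blast
  moreover have "x i \<in> spike (\<nu> i)" if "x \<in> closed_tube l'" "length l \<le> i" "i < length l'" for x i
  proof -
    have "2 / 2 ^ n \<le> (1 :: real)"
      using n(2) power_increasing[of 1 n "2 :: real"] by simp
    moreover have "i < n"
      using that(3) by (simp add: l'_def)
    ultimately have "\<bar>x i - p i\<bar> < 1"
      using near[OF that(1), of i] by linarith
    then show ?thesis
      using \<nu>[OF that(2)] by (auto simp: spike_def simp del: fact_Suc)
  qed
  ultimately have "refines C l l'"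
    unfolding refines_def using \<nu> n(2) by (intro conjI exI[of _ \<nu>]) (auto simp: l'_def)
  then show ?thesis ..
qed

text \<open>The centres, padded with zeros, stay in all earlier tubes and hence converge in each
  coordinate; the limit remains in these tubes because they are closed.\<close>

lemma nested_closed_tubes_inter:
  assumes nested: "\<And>n. closed_tube (l (Suc n)) \<subseteq> closed_tube (l n)"
    and len: "\<And>n. n \<le> length (l n)"
  obtains x where "\<And>n. x \<in> closed_tube (l n)"
proof -
  define y where "y n j = (if j < length (l n) then of_rat (l n ! j) else 0 :: real)" for n j
  have y: "y n \<in> closed_tube (l m)" if "m \<le> n" for m n
  proof -
    have "y n \<in> closed_tube (l n)"
      by (simp add: closed_tube_def y_def)
    then show ?thesis
      using lift_Suc_antimono_le[of "\<lambda>n. closed_tube (l n)", OF nested that] by blast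
  qed
  have "Cauchy (\<lambda>n. y n j)" for j
  proof (rule metric_CauchyI)
    fix e :: real assume "0 < e"
    have "(\<lambda>m. 2 / 2 ^ m :: real) \<longlonglongrightarrow> 0"
      by real_asymp
    then have "\<forall>\<^sub>F m in sequentially. 2 / 2 ^ m < e \<and> j < m"
      using \<open>0 < e\<close> by (intro eventually_conj order_tendstoD(2) eventually_gt_at_top)
    then obtain m where m: "2 / 2 ^ m < e" "j < m"
      by (auto simp: eventually_sequentially)
    have *: "\<bar>y n j - of_rat (l m ! j)\<bar> \<le> 1 / 2 ^ m" if "m \<le> n" for n
    proof -
      have "\<bar>y n j - of_rat (l m ! j)\<bar> \<le> 1 / 2 ^ length (l m)"
        using y[OF that] m(2) len[of m] by (simp add: closed_tube_def)
      also have "\<dots> \<le> 1 / 2 ^ m"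
        using len[of m] by (simp add: field_simps)
      finally show ?thesis .
    qed
    have "dist (y n j) (y n' j) < e" if "m \<le> n" "m \<le> n'" for n n'
      using *[OF that(1)] *[OF that(2)] m(1) by (simp add: dist_real_def abs_le_iff) linarith
    then show "\<exists>M. \<forall>m\<ge>M. \<forall>n\<ge>M. dist (y m j) (y n j) < e"
      by blast
  qed
  then have "\<exists>a. (\<lambda>n. y n j) \<longlonglongrightarrow> a" for j
    by (intro convergentD Cauchy_convergent)
  then obtain x where x: "\<And>j. (\<lambda>n. y n j) \<longlonglongrightarrow> x j"
    by metis
  have "x \<in> closed_tube (l m)" for m
  proof (rule Lim_in_closed_set[OF closed_closed_tube])
    show "\<forall>\<^sub>F n in sequentially. y n \<in> closed_tube (l m)"
      using eventually_ge_at_top[of m] by eventually_elim (rule y)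
    show "y \<longlonglongrightarrow> x"
      using x by (simp add: tendsto_fun_iff)
  qed simp
  then show thesis
    by (rule that)
qed

lemma ex_block:
  fixes g :: "nat \<Rightarrow> nat"
  assumes "strict_mono g" "g 0 = 0"
  shows "\<exists>k. g k \<le> i \<and> i < g (Suc k)"
proof (induction i)
  case 0
  show ?case
    using assms strict_monoD[OF assms(1), of 0 1] by (intro exI[of _ 0]) simp
next
  case (Suc i)
  then obtain k where k: "g k \<le> i" "i < g (Suc k)"
    by blast
  show ?case
  proof (cases "Suc i < g (Suc k)")
    case True
    with k show ?thesis
      by (intro exI[of _ k]) simp
  next
    case False
    with k(2) strict_monoD[OF assms(1), of "Suc k" "Suc (Suc k)"] show ?thesis
      by (intro exI[of _ "Suc k"]) simp
  qed
qed

text \<open>Stage \<open>n\<close> escapes \<open>C n\<close>, and the coordinates added there name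
  \<open>l n\<close>, whose tube contains the limit \<open>x\<close>. Thus \<open>x\<close> codes
  itself.\<close>

lemma self_coding_not_covered:
  assumes "\<And>n::nat. closed (C n)" "\<And>n. haar_meager (C n)"
  obtains x where "x \<in> self_coding" "\<And>n. x \<notin> C n"
proof -
  have "\<exists>l. \<forall>n. (n = 0 \<longrightarrow> l n = []) \<and> refines (C n) (l n) (l (Suc n))"
    using ex_refinement[OF assms] by (intro dependent_nat_choice) auto
  then obtain l where l: "l 0 = []" "\<And>n. refines (C n) (l n) (l (Suc n))"
    by blast
  \<comment> \<open>The block of stage \<open>n\<close> runs from \<open>g n\<close> to
    \<open>g (Suc n)\<close>; starting from the empty list lets the blocks cover all
    coordinates.\<close>
  define g where "g n = length (l n)" for n
  have g: "strict_mono g" "g 0 = 0"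
    using l unfolding g_def by (auto simp: strict_mono_Suc_iff refines_def)
  have tube: "tube (l n) \<subseteq> closed_tube (l n)" for n
    by (auto simp: tube_def closed_tube_def intro: less_imp_le)
  have step: "closed_tube (l (Suc n)) \<subseteq> tube (l n) - C n" for n
    using l(2)[of n] unfolding refines_def by blast
  have "\<exists>\<nu>. \<forall>i. g n \<le> i \<and> i < g (Suc n) \<longrightarrow>
      i \<le> \<nu> i \<and> tag (\<nu> i) = l n \<and> (\<forall>x\<in>closed_tube (l (Suc n)). x i \<in> spike (\<nu> i))" for n
    using l(2)[of n] unfolding refines_def g_def by blast
  then obtain \<nu> where \<nu>: "\<And>n i. g n \<le> i \<Longrightarrow> i < g (Suc n) \<Longrightarrow>
      i \<le> \<nu> n i \<and> tag (\<nu> n i) = l n \<and> (\<forall>x\<in>closed_tube (l (Suc n)). x i \<in> spike (\<nu> n i))"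
    by metis
  have len: "n \<le> length (l n)" for n
    using strict_mono_imp_increasing[OF g(1), of n] by (simp add: g_def)
  have nested: "closed_tube (l (Suc n)) \<subseteq> closed_tube (l n)" for n
    using step[of n] tube[of n] by blast
  obtain x where x: "\<And>n. x \<in> closed_tube (l n)"
    using nested_closed_tubes_inter[OF nested len] by blast
  have xt: "x \<in> tube (l n)" "x \<notin> C n" for n
    using x[of "Suc n"] step[of n] by auto
  obtain k where k: "\<And>i. g (k i) \<le> i \<and> i < g (Suc (k i))"
    using ex_block[OF g] by metis
  define \<mu> where "\<mu> i = \<nu> (k i) i" for i
  have \<mu>: "i \<le> \<mu> i \<and> tag (\<mu> i) = l (k i) \<and> x i \<in> spike (\<mu> i)" for i
    using \<nu>[of "k i" i] k[of i] x[of "Suc (k i)"] unfolding \<mu>_def by blast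
  have "k i \<le> k (Suc i)" for i
  proof -
    have "g (k i) < g (Suc (k (Suc i)))"
      using k[of i] k[of "Suc i"] by linarith
    then show ?thesis
      using g(1) by (simp add: strict_mono_less)
  qed
  then have "g (k i) \<le> g (k (Suc i))" for i
    using g(1) by (simp add: strict_mono_less_eq)
  then have "mono (\<lambda>i. length (tag (\<mu> i)))"
    using \<mu> by (intro mono_iff_le_Suc[THEN iffD2]) (simp add: g_def)
  moreover have "\<exists>i. n \<le> length (tag (\<mu> i))" for n
  proof -
    \<comment> \<open>Coordinate \<open>g n\<close> lies in block \<open>n\<close> or later, and the
      list of block \<open>k\<close> has at least \<open>k\<close> entries.\<close>
    have "g n < g (Suc (k (g n)))"
      using k[of "g n"] by blast
    then have "n \<le> k (g n)"
      using g(1) by (simp add: strict_mono_less)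
    then have "n \<le> length (l (k (g n)))"
      using len[of "k (g n)"] by linarith
    with \<mu>[of "g n"] show ?thesis
      by (intro exI[of _ "g n"]) simp
  qed
  ultimately have "code_of x \<mu>"
    using \<mu> xt(1) by (simp add: code_of_def)
  then have "x \<in> self_coding"
    using self_coding_iff by blast
  then show thesis
    using xt(2) by (rule that)
qed

section \<open>Assembly of the theorem\<close>

lemma continuous_on_scaleR_fun:
  "continuous_on UNIV (\<lambda>p :: real \<times> (nat \<Rightarrow> real). fst p *\<^sub>R snd p)"
  unfolding scaleR_fun_def
proof (rule continuous_on_coordinatewise_then_product)
  fix i
  have "continuous_on UNIV (\<lambda>p :: real \<times> (nat \<Rightarrow> real). snd p i)"
    by (rule continuous_on_product_then_coordinatewise[OF continuous_on_snd[OF continuous_on_id]])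
  then show "continuous_on UNIV (\<lambda>p :: real \<times> (nat \<Rightarrow> real). fst p *\<^sub>R snd p i)"
    by (intro continuous_on_scaleR continuous_on_fst continuous_on_id)
qed

theorem theorem2:
  shows "\<exists>L :: (nat \<Rightarrow> real) set.
    L \<in> sets borel \<and> subspace L \<and> haar_meager L \<and> haar_null L \<and>
    \<not> (\<exists>\<C>. countable \<C> \<and> (\<forall>C\<in>\<C>. closed C \<and> haar_meager C) \<and> L \<subseteq> \<Union>\<C>)"
proof (intro exI conjI)
  let ?L = "span self_coding"
  show borel: "?L \<in> sets borel"
    by (rule span_borel[OF continuous_on_scaleR_fun self_coding_def open_coding_stage
          independent_self_coding])
  show "subspace ?L"
    by (rule subspace_span)
  have discrete: "z = 0" if "z \<in> ?L" "\<And>i. \<bar>z i\<bar> \<le> 1" for z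
    using that by (rule bounded_span_self_coding)
  show "haar_meager ?L"
    using borel subspace_span discrete by (rule haar_meager_discrete)
  show "haar_null ?L"
    using borel subspace_span discrete by (rule haar_null_discrete)
  show "\<not> (\<exists>\<C>. countable \<C> \<and> (\<forall>C\<in>\<C>. closed C \<and> haar_meager C) \<and> ?L \<subseteq> \<Union>\<C>)"
  proof
    assume "\<exists>\<C>. countable \<C> \<and> (\<forall>C\<in>\<C>. closed C \<and> haar_meager C) \<and> ?L \<subseteq> \<Union>\<C>"
    then obtain \<C> where \<C>: "countable \<C>" "\<And>C. C \<in> \<C> \<Longrightarrow> closed C \<and> haar_meager C" "?L \<subseteq> \<Union>\<C>"
      by blast
    \<comment> \<open>The span contains 0, so the cover is nonempty and can be listed as a
      sequence.\<close>
    have "\<C> \<noteq> {}"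
      using \<C>(3) span_zero by blast
    then have rng: "range (from_nat_into \<C>) = \<C>"
      using \<C>(1) by simp
    then have "closed (from_nat_into \<C> n)" "haar_meager (from_nat_into \<C> n)" for n
      using \<C>(2) by blast+
    then obtain x where x: "x \<in> self_coding" "\<And>n. x \<notin> from_nat_into \<C> n"
      using self_coding_not_covered[of "from_nat_into \<C>"] by blast
    moreover have "x \<in> \<Union>\<C>"
      using \<C>(3) x(1) span_base by blast
    ultimately show False
      using rng by blast
  qed
qed

end
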